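(* Let $n$ be a positive integer and let $\beta$ be a real number with $\beta\ge e^{n+1}+e^n$ if $n$ is odd, and $\beta\ge e^{n+1}-e^n$ if $n$ is even. If $p\in\mathcal{H}_1$ satisfies $$1+\beta(zp'(z))^n\prec e^z,$$ then $p(z)\prec e^z$.
   Context: $\mathbb{D}=\{z\in\mathbb{C}:|z|<1\}$. $\mathcal{H}_1$ is the class of analytic functions on $\mathbb{D}$ of the form $p(z)=1+a_1z+a_2z^2+\cdots$. For functions $F,G$ analytic in $\mathbb{D}$, $F\prec G$ (F is subordinate to G) means there is an analytic $w:\mathbb{D}\to\mathbb{C}$ with $w(0)=0$, $|w(z)|<1$ and $F(z)=G(w(z))$ for all $z\in\mathbb{D}$. *)

theory Defs
  imports "HOL-Complex_Analysis.Complex_Analysis"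
begin

abbreviation unit_disc :: "complex set" where
  "unit_disc \<equiv> ball 0 1"

text \<open>
  Functions are total on the type of complex numbers; only their values on the unit disc matter.
\<close>

definition class_H1 :: "(complex \<Rightarrow> complex) set" where
  "class_H1 = {p. p analytic_on unit_disc \<and>
     (\<exists>a :: nat \<Rightarrow> complex. a 0 = 1 \<and> (\<forall>z \<in> unit_disc. (\<lambda>k. a k * z ^ k) sums p z))}"

text \<open>
  The relation is only meant for \<open>F\<close> and \<open>G\<close> analytic on the unit disc.
\<close>

definition subordinate :: "(complex \<Rightarrow> complex) \<Rightarrow> (complex \<Rightarrow> complex) \<Rightarrow> bool"
    (infix "\<prec>\<^sub>s" 50) where
  "F \<prec>\<^sub>s G \<longleftrightarrow>
     (\<exists>w. w analytic_on unit_disc \<and> w 0 = 0 \<and>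
          (\<forall>z \<in> unit_disc. norm (w z) < 1) \<and>
          (\<forall>z \<in> unit_disc. F z = G (w z)))"

lemma class_H1_iff: "p \<in> class_H1 \<longleftrightarrow> p analytic_on unit_disc \<and> p 0 = 1"
proof (intro iffI conjI)
  assume p: "p \<in> class_H1"
  then show "p analytic_on unit_disc" by (simp add: class_H1_def)
  from p obtain a :: "nat \<Rightarrow> complex" where a: "a 0 = 1"
    "\<And>z. z \<in> unit_disc \<Longrightarrow> (\<lambda>k. a k * z ^ k) sums p z"
    by (auto simp: class_H1_def)
  have "(\<lambda>k. a k * 0 ^ k) sums p 0" using a(2)[of 0] by simp
  moreover have "(\<lambda>k. a k * 0 ^ k) sums a 0" by (rule powser_sums_zero)
  ultimately show "p 0 = 1" using a(1) sums_unique2 by metis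
next
  assume p: "p analytic_on unit_disc \<and> p 0 = 1"
  define a where "a = (\<lambda>k. (deriv ^^ k) p 0 / fact k)"
  have "p holomorphic_on unit_disc" using p by (simp add: analytic_imp_holomorphic)
  then have "(\<lambda>k. a k * z ^ k) sums p z" if "z \<in> unit_disc" for z
    using holomorphic_power_series[of p 0 1 z] that by (simp add: a_def)
  moreover have "a 0 = 1" using p by (simp add: a_def)
  ultimately show "p \<in> class_H1" using p by (auto simp: class_H1_def)
qed

end

theory Submission
  imports Defs
begin

text \<open>
  On the unit disc \<open>\<bar>e\<^sup>w - 1\<bar> < e - 1\<close>, so the hypothesis forces
  \<open>\<beta> \<bar>z p'(z)\<bar>\<^sup>n < e - 1\<close>; as \<open>\<beta> \<ge> e\<^sup>n (e - 1)\<close> for both parities of \<open>n\<close>, this gives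
  \<open>\<bar>z p'(z)\<bar> < 1/e < 1/2\<close>. By the Schwarz lemma \<open>\<bar>p'\<bar> \<le> 1/2\<close>, hence \<open>\<bar>p - 1\<bar> < 1/2\<close>,
  and the principal logarithm of \<open>p\<close> is a Schwarz function witnessing the subordination.
\<close>

text \<open>Triangle inequality applied termwise to the series of \<open>exp z - 1\<close>: its
  coefficients are positive, so the majorant is the same series at \<open>norm z\<close>.\<close>

lemma norm_exp_minus_one_le:
  fixes z :: "'a::{real_normed_field,banach}"
  shows "norm (exp z - 1) \<le> exp (norm z) - 1"
proof -
  have sum: "summable (\<lambda>n. norm z ^ Suc n /\<^sub>R fact (Suc n))"
    by (subst summable_Suc_iff) (rule summable_exp_generic)
  have "exp z - 1 = (\<Sum>n. z ^ Suc n /\<^sub>R fact (Suc n))"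
    using exp_first_term[of z] by (simp del: fact_Suc)
  also have "norm \<dots> \<le> (\<Sum>n. norm z ^ Suc n /\<^sub>R fact (Suc n))"
    by (rule norm_suminf_le[OF _ sum]) (simp add: norm_mult norm_power del: fact_Suc)
  also have "\<dots> = exp (norm z) - 1"
    using exp_first_term[of "norm z"] by (simp del: fact_Suc)
  finally show ?thesis .
qed

text \<open>The Schwarz lemma strips off the factor \<open>z\<close>:
  \<open>z * deriv f z / c\<close> vanishes at 0 and maps the disc into itself.\<close>

lemma norm_deriv_le_if_norm_mult_deriv_less:
  assumes holf: "f holomorphic_on ball 0 1" and "c > 0"
    and bound: "\<And>z. norm z < 1 \<Longrightarrow> norm (z * deriv f z) < c"
    and z: "norm z < 1"
  shows "norm (deriv f z) \<le> c"
proof -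
  define g where "g = (\<lambda>z. z * deriv f z / of_real c)"
  have hold: "deriv f holomorphic_on ball 0 1"
    by (rule holomorphic_deriv[OF holf]) simp
  have holg: "g holomorphic_on ball 0 1"
    unfolding g_def using \<open>c > 0\<close> by (intro holomorphic_intros hold) auto
  have g0: "g 0 = 0" by (simp add: g_def)
  have g1: "norm (g w) < 1" if "norm w < 1" for w
    using bound[OF that] \<open>c > 0\<close> by (simp add: g_def norm_divide)
  note Schwarz = Schwarz_Lemma(1,2)[OF holg g0 g1 z]
  show ?thesis
  proof (cases "z = 0")
    case False
    then show ?thesis
      using Schwarz(1) \<open>c > 0\<close> by (simp add: g_def norm_divide norm_mult field_simps)
  next
    \<comment> \<open>Division by \<open>z\<close> fails here; the bound on \<open>deriv g 0\<close>
      in the Schwarz lemma takes its place.\<close>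
    case True
    have "(deriv f has_field_derivative deriv (deriv f) 0) (at 0)"
      by (rule holomorphic_derivI[OF hold]) auto
    then have "(g has_field_derivative deriv f 0 / of_real c) (at 0)"
      unfolding g_def using \<open>c > 0\<close> by (auto intro!: derivative_eq_intros)
    then have "deriv g 0 = deriv f 0 / of_real c"
      by (rule DERIV_imp_deriv)
    then show ?thesis
      using Schwarz(2) True \<open>c > 0\<close> by (simp add: norm_divide)
  qed
qed

lemma subordinate_exp_if_norm_minus_one_less:
  assumes holp: "p holomorphic_on unit_disc" and "p 0 = 1"
    and bound: "\<And>z. z \<in> unit_disc \<Longrightarrow> norm (p z - 1) < 1/2"
  shows "p \<prec>\<^sub>s exp"
proof -
  \<comment> \<open>A positive real part keeps \<open>p\<close> off the branch cut of
    \<open>Ln\<close>.\<close>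
  have "Re (p z) > 0" if "z \<in> unit_disc" for z
    using bound[OF that] abs_Re_le_cmod[of "p z - 1"] by simp
  then have nonpos: "p z \<notin> \<real>\<^sub>\<le>\<^sub>0" if "z \<in> unit_disc" for z
    using that by (force simp: complex_nonpos_Reals_iff)
  have "(\<lambda>z. Ln (p z)) holomorphic_on unit_disc"
    using nonpos by (intro holomorphic_intros holp)
  then have "(\<lambda>z. Ln (p z)) analytic_on unit_disc"
    by (simp add: analytic_on_open)
  \<comment> \<open>The radius 1/2 comes from |Ln(1 + u)| \<le> 2|u|, valid for |u| < 1/2.\<close>
  moreover have "norm (Ln (p z)) < 1" if "z \<in> unit_disc" for z
    using norm_Ln_le[of "p z - 1"] bound[OF that] by simp
  moreover have "p z = exp (Ln (p z))" if "z \<in> unit_disc" for z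
    using nonpos[OF that] by (subst exp_Ln) auto
  ultimately show ?thesis
    unfolding subordinate_def using \<open>p 0 = 1\<close> by (intro exI[of _ "\<lambda>z. Ln (p z)"]) auto
qed

theorem theorem4p1:
  fixes n :: nat and \<beta> :: real and p :: "complex \<Rightarrow> complex"
  assumes "n > 0"
    and "odd n \<Longrightarrow> \<beta> \<ge> exp (real (n + 1)) + exp (real n)"
    and "even n \<Longrightarrow> \<beta> \<ge> exp (real (n + 1)) - exp (real n)"
    and "p \<in> class_H1"
    and "(\<lambda>z. 1 + complex_of_real \<beta> * (z * deriv p z) ^ n) \<prec>\<^sub>s exp"
  shows "p \<prec>\<^sub>s exp"
proof -
  have holp: "p holomorphic_on unit_disc" and p0: "p 0 = 1"
    using assms(4) by (auto simp: class_H1_iff analytic_imp_holomorphic)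
  \<comment> \<open>This relaxes the bound 1/e on |z p'(z)| to the radius 1/2 that the logarithm
    estimate asks for.\<close>
  have e2: "exp (1::real) \<ge> 2"
    using exp_ge_add_one_self[of 1] by simp
  have "exp (real (n + 1)) - exp (real n) \<le> \<beta>"
    using assms(2,3) exp_gt_zero[of "real n"] by (cases "even n") (force, smt (verit))
  then have \<beta>: "\<beta> \<ge> exp 1 ^ n * (exp 1 - 1)"
    by (simp add: exp_add exp_of_nat_mult[of n 1, simplified] algebra_simps)
  obtain w where w: "\<And>z. z \<in> unit_disc \<Longrightarrow> norm (w z) < 1"
    "\<And>z. z \<in> unit_disc \<Longrightarrow> 1 + complex_of_real \<beta> * (z * deriv p z) ^ n = exp (w z)"
    using assms(5) unfolding subordinate_def by blast
  have small: "norm (z * deriv p z) < 1/2" if "norm z < 1" for z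
  proof -
    let ?r = "norm (z * deriv p z)"
    have z: "z \<in> unit_disc" using that by simp
    \<comment> \<open>The factor e^n of the lower bound for \<open>\<beta>\<close> is absorbed into
      the n-th power; the remaining e - 1 cancels against the bound on |e^w - 1|.\<close>
    have "(exp 1 * ?r) ^ n * (exp 1 - 1) \<le> \<beta> * ?r ^ n"
      using mult_right_mono[OF \<beta>, of "?r ^ n"] by (simp add: power_mult_distrib mult_ac)
    also have "\<dots> \<le> norm (complex_of_real \<beta> * (z * deriv p z) ^ n)"
      by (simp add: norm_mult norm_power mult_right_mono)
    also have "complex_of_real \<beta> * (z * deriv p z) ^ n = exp (w z) - 1"
      using w(2)[OF z] by (simp add: algebra_simps)
    also have "norm \<dots> \<le> exp (norm (w z)) - 1"
      by (rule norm_exp_minus_one_le)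
    also have "\<dots> < exp 1 - 1"
      using w(1)[OF z] by simp
    finally have "(exp 1 * ?r) ^ n < 1 ^ n"
      using e2 by simp
    then have "exp 1 * ?r < 1"
      by (rule power_less_imp_less_base) simp
    then show ?thesis
      using mult_right_mono[OF e2 norm_ge_zero[of "z * deriv p z"]] by linarith
  qed
  show ?thesis
  proof (rule subordinate_exp_if_norm_minus_one_less[OF holp p0])
    fix z assume z: "z \<in> unit_disc"
    \<comment> \<open>Mean value inequality on the convex disc; strictness then comes from |z| <
      1.\<close>
    have "norm (p z - p 0) \<le> 1/2 * norm (z - 0)"
    proof (rule field_differentiable_bound[of unit_disc])
      show "(p has_field_derivative deriv p x) (at x within unit_disc)" if "x \<in> unit_disc" for x
        using holomorphic_derivI[OF holp open_ball that] by (rule has_field_derivative_at_within)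
      show "norm (deriv p x) \<le> 1/2" if "x \<in> unit_disc" for x
        using norm_deriv_le_if_norm_mult_deriv_less[OF holp _ small] that by simp
    qed (use z in auto)
    then show "norm (p z - 1) < 1/2" using z p0 by simp
  qed
qed

end
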